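(* Let $f\colon [0,\infty)\to\mathbb{R}$ be a real analytic function (analytic on $[0,\infty)$, including at the endpoint $0$) such that the set $$U=\{u>0 : (f(ku))_{k\geq 1}\in \mathcal{G}\}$$ is uncountable. Then $f$ is a polynomial.
   Context: A sequence of real numbers $(a_k)_{k\ge1}$ is called pointwise good (written $(a_k)\in\mathcal{G}$) if for every measure preserving flow $(U_t)_{t\in\mathbb{R}}$ on a probability space $(X,\mathcal{B},\mu)$ (a measurable action of $\mathbb{R}$ by measure preserving transformations) and every $F\in L^\infty(X,\mu)$, the averages $\frac1n\sum_{k=1}^n F(U_{a_k}x)$ converge for $\mu$-almost every $x$ as $n\to\infty$. *)

theory Defs
  imports "HOL-Probability.Probability" "HOL-Computational_Algebra.Polynomial"
begin

definition measure_preserving_flow :: "'a measure \<Rightarrow> (real \<Rightarrow> 'a \<Rightarrow> 'a) \<Rightarrow> bool" where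
  "measure_preserving_flow M U \<longleftrightarrow>
     prob_space M \<and>
     (\<forall>t. U t \<in> measurable M M \<and> distr M M (U t) = M) \<and>
     (\<forall>x\<in>space M. U 0 x = x) \<and>
     (\<forall>s t. \<forall>x\<in>space M. U (s + t) x = U s (U t x)) \<and>
     (\<lambda>(t, x). U t x) \<in> measurable (borel \<Otimes>\<^sub>M M) M"

definition pointwise_good :: "(nat \<Rightarrow> real) \<Rightarrow> bool" where
  "pointwise_good a \<longleftrightarrow>
     (\<forall>(M :: (nat \<Rightarrow> real) measure) U (F :: (nat \<Rightarrow> real) \<Rightarrow> real).
        measure_preserving_flow M U \<longrightarrow>
        F \<in> borel_measurable M \<longrightarrow>
        (\<exists>C. AE x in M. \<bar>F x\<bar> \<le> C) \<longrightarrow>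
        (AE x in M. convergent (\<lambda>n. (\<Sum>k=1..n. F (U (a k) x)) / real n)))"

definition real_analytic_on :: "(real \<Rightarrow> real) \<Rightarrow> real set \<Rightarrow> bool" where
  "real_analytic_on f S \<longleftrightarrow>
     (\<forall>x\<in>S. \<exists>r>0. \<exists>c :: nat \<Rightarrow> real.
        \<forall>y\<in>S. \<bar>y - x\<bar> < r \<longrightarrow> (\<lambda>n. c n * (y - x) ^ n) sums f y)"

end

theory Submission
  imports Defs "HOL-Complex_Analysis.Cauchy_Integral_Formula" "HOL-Analysis.Kronecker_Approximation_Theorem"
begin

text \<open>
  If \<open>f(ku)\<close>, \<open>k \<ge> 1\<close>, satisfies a nontrivial integer relation for uncountably many \<open>u\<close>, then by
  countability of the set of relations a single one holds for uncountably many \<open>u\<close>, hence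
  identically: \<open>\<Sum>k\<le>N. c\<^sub>k f(kx) = 0\<close>. Comparing Taylor coefficients at \<open>0\<close> gives
  \<open>f\<^sub>m \<cdot> \<Sum>k\<le>N. c\<^sub>k k\<^sup>m = 0\<close>, and the second factor is nonzero for large \<open>m\<close>; so \<open>f\<close> is a polynomial.

  It remains to see that a sequence \<open>a\<close> linearly independent over the integers is never pointwise
  good. By Kronecker's theorem, a rotation flow on a circle can be given a speed \<open>s\<close> such that
  \<open>s a\<^sub>1, \<dots>, s a\<^sub>N\<close> follow any prescribed pattern modulo \<open>1\<close>. Letting the pattern rest at equally spaced
  points during blocks of rapidly increasing length, every orbit spends most of some long initial
  segment in one fixed short arc. On a product of infinitely many such circles, the union of these
  arcs (one in each coordinate) has measure at most \<open>1/4\<close>, while every point has infinitely many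
  averages \<open>\<ge> 3/4\<close>. By dominated convergence the averages cannot converge almost everywhere.
\<close>

section \<open>Zeros of real analytic functions on the half-line\<close>

text \<open>The expansion is known only at nonnegative points, so it is one-sided at the endpoint 0.
  Convergence to the right of \<open>x\<close> already forces convergence on the full interval
  around \<open>x\<close>, where zeros of a nonzero power series are isolated.\<close>

lemma power_series_zeros_isolated:
  fixes h :: "real \<Rightarrow> real"
  assumes "r > 0" "x \<ge> 0" "c m \<noteq> 0"
    and sums: "\<And>y. y \<ge> 0 \<Longrightarrow> \<bar>y - x\<bar> < r \<Longrightarrow> (\<lambda>n. c n * (y - x) ^ n) sums h y"
  shows "\<exists>s>0. \<forall>y\<ge>0. 0 < \<bar>y - x\<bar> \<and> \<bar>y - x\<bar> < s \<longrightarrow> h y \<noteq> 0"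
proof -
  define g where "g y = (\<Sum>n. c n * (y - x) ^ n)" for y
  have g_sums: "(\<lambda>n. c n * (y - x) ^ n) sums g y" if "\<bar>y - x\<bar> < r" for y
  proof -
    \<comment> \<open>\<open>x + z\<close> lies to the right of \<open>x\<close>, hence is
      nonnegative, and \<open>z\<close> is strictly between \<open>\<bar>y - x\<bar>\<close> and
      \<open>r\<close>.\<close>
    define z where "z = (\<bar>y - x\<bar> + r) / 2"
    have "summable (\<lambda>n. c n * z ^ n)"
      using sums[of "x + z"] that assms(1,2) by (auto simp: z_def sums_iff)
    then have "summable (\<lambda>n. c n * (y - x) ^ n)"
      by (rule powser_inside) (use that in \<open>auto simp: z_def\<close>)
    then show ?thesis
      by (simp add: g_def summable_sums)
  qed
  \<comment> \<open>Multiplying by \<open>y - x\<close> removes the need to treat the case \<open>g x \<noteq> 0\<close> separately.\<close>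
  define b where "b n = (case n of 0 \<Rightarrow> 0 | Suc k \<Rightarrow> c k)" for n
  have "(\<lambda>n. b n * (y - x) ^ n) sums ((y - x) * g y)" if "norm (y - x) < r" for y
  proof -
    have "(\<lambda>n. b (Suc n) * (y - x) ^ Suc n) sums ((y - x) * g y)"
      using sums_mult[OF g_sums[of y], of "y - x"] that by (simp add: b_def mult_ac)
    then show ?thesis
      by (subst (asm) sums_Suc_iff) (simp add: b_def)
  qed
  then obtain s where s: "s > 0" "\<And>y. y \<in> cball x s - {x} \<Longrightarrow> (y - x) * g y \<noteq> 0"
    using powser_0_nonzero[of r x b "\<lambda>y. (y - x) * g y" "Suc m"] assms by (auto simp: b_def)
  have "h y \<noteq> 0" if "y \<ge> 0" "0 < \<bar>y - x\<bar>" "\<bar>y - x\<bar> < min r s" for y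
    using s(2)[of y] g_sums[of y] sums[of y] that by (auto simp: dist_real_def abs_minus_commute dest: sums_unique2)
  then show ?thesis
    using \<open>r > 0\<close> \<open>s > 0\<close> by (intro exI[of _ "min r s"]) auto
qed

lemma real_analytic_zeros_dichotomy:
  assumes "real_analytic_on h {0..}" "x \<ge> 0"
  shows "(\<exists>s>0. \<forall>y\<ge>0. \<bar>y - x\<bar> < s \<longrightarrow> h y = 0) \<or>
         (\<exists>s>0. \<forall>y\<ge>0. 0 < \<bar>y - x\<bar> \<and> \<bar>y - x\<bar> < s \<longrightarrow> h y \<noteq> 0)"
proof -
  obtain r c where rc: "r > 0" "\<And>y. y \<ge> 0 \<Longrightarrow> \<bar>y - x\<bar> < r \<Longrightarrow> (\<lambda>n. c n * (y - x) ^ n) sums h y"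
    using assms unfolding real_analytic_on_def by (metis atLeast_iff)
  show ?thesis
  proof (cases "\<exists>m. c m \<noteq> 0")
    case True
    then show ?thesis
      using power_series_zeros_isolated[of r x c _ h] rc assms(2) by blast
  next
    case False
    then have "h y = 0" if "y \<ge> 0" "\<bar>y - x\<bar> < r" for y
      using rc(2)[OF that] by (simp add: sums_iff)
    then show ?thesis
      using \<open>r > 0\<close> by blast
  qed
qed

text \<open>By the dichotomy the set \<open>A\<close> of points near which \<open>h\<close> vanishes
  is open and closed in the connected half-line. If \<open>A\<close> were empty, zeros could not
  accumulate, so each compact interval would hold finitely many and there would be only countably
  many in all.\<close>

lemma real_analytic_identity:
  assumes h: "real_analytic_on h {0..}" and unc: "uncountable {x. x \<ge> 0 \<and> h x = 0}"
    and "x \<ge> 0"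
  shows "h x = 0"
proof -
  define A where "A = {x. x \<ge> 0 \<and> (\<exists>s>0. \<forall>y\<ge>0. \<bar>y - x\<bar> < s \<longrightarrow> h y = 0)}"
  have "openin (top_of_set {0..}) A"
    unfolding openin_euclidean_subtopology_iff
  proof (intro conjI ballI)
    fix a assume "a \<in> A"
    then obtain s where s: "s > 0" "\<forall>y\<ge>0. \<bar>y - a\<bar> < s \<longrightarrow> h y = 0"
      by (auto simp: A_def)
    have "b \<in> A" if "b \<ge> 0" "dist b a < s" for b
    proof -
      have "\<forall>y\<ge>0. \<bar>y - b\<bar> < s - \<bar>b - a\<bar> \<longrightarrow> h y = 0"
        using s by auto
      with that show ?thesis
        by (auto simp: A_def dist_real_def intro!: exI[of _ "s - \<bar>b - a\<bar>"])
    qed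
    then show "\<exists>e>0. \<forall>x'\<in>{0..}. dist x' a < e \<longrightarrow> x' \<in> A"
      using \<open>s > 0\<close> by auto
  qed (auto simp: A_def)
  moreover have "openin (top_of_set {0..}) ({0..} - A)"
    unfolding openin_euclidean_subtopology_iff
  proof (intro conjI ballI)
    fix a assume "a \<in> {0..} - A"
    then have "a \<ge> 0" "a \<notin> A" by auto
    with real_analytic_zeros_dichotomy[OF h, of a] obtain s
      where s: "s > 0" "\<forall>y\<ge>0. 0 < \<bar>y - a\<bar> \<and> \<bar>y - a\<bar> < s \<longrightarrow> h y \<noteq> 0"
      by (auto simp: A_def)
    have "b \<notin> A" if "b \<ge> 0" "dist b a < s" for b
    proof (cases "b = a")
      case False
      then have "h b \<noteq> 0"
        using s that by (auto simp: dist_real_def)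
      then show ?thesis
        using that by (force simp: A_def)
    qed (use \<open>a \<notin> A\<close> in auto)
    then show "\<exists>e>0. \<forall>x'\<in>{0..}. dist x' a < e \<longrightarrow> x' \<in> {0..} - A"
      using \<open>s > 0\<close> by auto
  qed auto
  ultimately have A: "A = {} \<or> A = {0..}"
    using connected_clopen[of "{0::real..}"] by (simp add: closedin_def openin_imp_subset)
  have "A \<noteq> {}"
  proof
    assume "A = {}"
    have fin: "finite {x \<in> {0..real n}. h x = 0}" for n
    proof (rule ccontr)
      assume "infinite {x \<in> {0..real n}. h x = 0}"
      then obtain a where a: "a \<in> {0..real n}" "a islimpt {x \<in> {0..real n}. h x = 0}"
        using Heine_Borel_imp_Bolzano_Weierstrass[of "{0..real n}" "{x \<in> {0..real n}. h x = 0}"]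
        by (metis (no_types, lifting) compact_Icc mem_Collect_eq subsetI)
      with real_analytic_zeros_dichotomy[OF h, of a] \<open>A = {}\<close> obtain s
        where s: "s > 0" "\<forall>y\<ge>0. 0 < \<bar>y - a\<bar> \<and> \<bar>y - a\<bar> < s \<longrightarrow> h y \<noteq> 0"
        by (auto simp: A_def)
      then show False
        using a by (force simp: islimpt_approachable dist_real_def)
    qed
    have "{x. x \<ge> 0 \<and> h x = 0} \<subseteq> (\<Union>n. {x \<in> {0..real n}. h x = 0})"
      using real_arch_simple by fastforce
    moreover have "countable (\<Union>n. {x \<in> {0..real n}. h x = 0})"
      using fin by (intro countable_UN) (auto intro: countable_finite)
    ultimately show False
      using unc countable_subset by blast
  qed
  with A \<open>x \<ge> 0\<close> have "x \<in> A" by auto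
  then show ?thesis
    using \<open>x \<ge> 0\<close> by (auto simp: A_def)
qed

section \<open>Closure properties of real analytic functions\<close>

lemma real_analytic_on_sum:
  assumes "finite K" "\<And>k. k \<in> K \<Longrightarrow> real_analytic_on (F k) S"
  shows "real_analytic_on (\<lambda>x. \<Sum>k\<in>K. F k x) S"
  unfolding real_analytic_on_def
proof
  fix x assume "x \<in> S"
  then have "\<forall>k\<in>K. \<exists>r c. r > 0 \<and> (\<forall>y\<in>S. \<bar>y - x\<bar> < r \<longrightarrow> (\<lambda>n. c n * (y - x) ^ n) sums F k y)"
    using assms(2) unfolding real_analytic_on_def by meson
  then obtain r c where rc: "\<And>k. k \<in> K \<Longrightarrow> r k > 0"
    "\<And>k y. k \<in> K \<Longrightarrow> y \<in> S \<Longrightarrow> \<bar>y - x\<bar> < r k \<Longrightarrow> (\<lambda>n. c k n * (y - x) ^ n) sums F k y"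
    by metis
  \<comment> \<open>Inserting 1 keeps \<open>Min\<close> meaningful when \<open>K\<close> is
    empty.\<close>
  define R where "R = Min (insert 1 (r ` K))"
  have "R > 0" "\<And>k. k \<in> K \<Longrightarrow> R \<le> r k"
    using assms(1) rc(1) by (auto simp: R_def)
  moreover have "(\<lambda>n. (\<Sum>k\<in>K. c k n) * (y - x) ^ n) sums (\<Sum>k\<in>K. F k y)"
    if "y \<in> S" "\<bar>y - x\<bar> < R" for y
    unfolding sum_distrib_right using that calculation
    by (intro sums_sum rc(2)) force+
  ultimately show "\<exists>r>0. \<exists>c. \<forall>y\<in>S. \<bar>y - x\<bar> < r \<longrightarrow> (\<lambda>n. c n * (y - x) ^ n) sums (\<Sum>k\<in>K. F k y)"
    by (intro exI[of _ R] conjI exI[of _ "\<lambda>n. \<Sum>k\<in>K. c k n"]) auto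
qed

lemma real_analytic_on_scaled:
  assumes "real_analytic_on f {0..}" "k > 0"
  shows "real_analytic_on (\<lambda>x. b * f (k * x)) {0..}"
  unfolding real_analytic_on_def
proof
  fix x :: real assume "x \<in> {0..}"
  then have "k * x \<in> {0..}"
    using \<open>k > 0\<close> by simp
  then obtain r c where rc: "r > 0"
    "\<And>y. y \<ge> 0 \<Longrightarrow> \<bar>y - k * x\<bar> < r \<Longrightarrow> (\<lambda>n. c n * (y - k * x) ^ n) sums f y"
    using assms(1) unfolding real_analytic_on_def by (metis atLeast_iff)
  have "(\<lambda>n. (b * c n * k ^ n) * (y - x) ^ n) sums (b * f (k * y))"
    if "y \<ge> 0" "\<bar>y - x\<bar> < r / k" for y
  proof -
    have "k * y - k * x = k * (y - x)"
      by (simp add: algebra_simps)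
    moreover have "\<bar>k * (y - x)\<bar> < r"
      using that \<open>k > 0\<close> by (simp add: abs_mult pos_less_divide_eq mult.commute)
    ultimately show ?thesis
      using sums_mult[OF rc(2)[of "k * y"], of b] that \<open>k > 0\<close>
      by (simp add: power_mult_distrib mult_ac)
  qed
  then show "\<exists>r>0. \<exists>c. \<forall>y\<in>{0..}. \<bar>y - x\<bar> < r \<longrightarrow> (\<lambda>n. c n * (y - x) ^ n) sums (b * f (k * y))"
    using \<open>r > 0\<close> \<open>k > 0\<close>
    by (intro exI[of _ "r / k"] conjI exI[of _ "\<lambda>n. b * c n * k ^ n"]) auto
qed

lemma poly_sums: "(\<lambda>n. coeff p n * x ^ n) sums poly p (x :: real)"
  unfolding poly_altdef by (rule sums_finite) (auto simp: coeff_eq_0)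

lemma real_analytic_on_diff_poly:
  assumes "real_analytic_on f S"
  shows "real_analytic_on (\<lambda>x. f x - poly p x) S"
  unfolding real_analytic_on_def
proof
  fix x assume "x \<in> S"
  then obtain r c where rc: "r > 0"
    "\<And>y. y \<in> S \<Longrightarrow> \<bar>y - x\<bar> < r \<Longrightarrow> (\<lambda>n. c n * (y - x) ^ n) sums f y"
    using assms unfolding real_analytic_on_def by metis
  \<comment> \<open>\<open>q\<close> is \<open>p\<close> re-expanded around \<open>x\<close>: its
    value at \<open>y - x\<close> is the value of \<open>p\<close> at \<open>y\<close>.\<close>
  define q where "q = pcompose p [:x, 1:]"
  have "(\<lambda>n. (c n - coeff q n) * (y - x) ^ n) sums (f y - poly p y)" if "y \<in> S" "\<bar>y - x\<bar> < r" for y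
    using sums_diff[OF rc(2)[OF that] poly_sums[of q "y - x"]]
    by (simp add: q_def poly_pcompose left_diff_distrib)
  then show "\<exists>r>0. \<exists>c. \<forall>y\<in>S. \<bar>y - x\<bar> < r \<longrightarrow> (\<lambda>n. c n * (y - x) ^ n) sums (f y - poly p y)"
    using \<open>r > 0\<close> by (intro exI[of _ r] conjI exI[of _ "\<lambda>n. c n - coeff q n"]) auto
qed

section \<open>From integer relations between dilates to polynomials\<close>

text \<open>The largest index \<open>K\<close> with nonzero coefficient dominates: divided by
  \<open>K ^ m\<close>, the sum tends to \<open>c K\<close>.\<close>

lemma eventually_power_sum_nonzero:
  fixes c :: "nat \<Rightarrow> int"
  assumes "k0 \<in> {1..N}" "c k0 \<noteq> 0"
  shows "\<forall>\<^sub>F m in sequentially. (\<Sum>k=1..N. of_int (c k) * real k ^ m) \<noteq> 0"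
proof -
  define K where "K = Max {k \<in> {1..N}. c k \<noteq> 0}"
  have "K \<in> {k \<in> {1..N}. c k \<noteq> 0}"
    unfolding K_def using assms by (intro Max_in) auto
  then have K: "1 \<le> K" "K \<le> N" "c K \<noteq> 0" by auto
  have above: "k \<le> K" if "k \<in> {1..N}" "c k \<noteq> 0" for k
    unfolding K_def using that by (intro Max_ge) auto
  have "(\<lambda>m. of_int (c k) * (real k / real K) ^ m) \<longlonglongrightarrow> (if k = K then of_int (c K) else 0)"
    if "k \<in> {1..N}" for k
  proof (cases "c k = 0 \<or> k = K")
    case False
    with above[of k] that have "k < K" by force
    then have "(\<lambda>m. (real k / real K) ^ m) \<longlonglongrightarrow> 0"
      by (intro LIMSEQ_realpow_zero) auto
    from tendsto_mult_right_zero[OF this] show ?thesis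
      using False by simp
  qed (use K in auto)
  then have "(\<lambda>m. \<Sum>k=1..N. of_int (c k) * (real k / real K) ^ m) \<longlonglongrightarrow>
      (\<Sum>k=1..N. if k = K then of_int (c K) else 0)"
    by (intro tendsto_sum)
  then have "(\<lambda>m. \<Sum>k=1..N. of_int (c k) * (real k / real K) ^ m) \<longlonglongrightarrow> of_int (c K)"
    using K by simp
  then have "\<forall>\<^sub>F m in sequentially. (\<Sum>k=1..N. of_int (c k) * (real k / real K) ^ m) \<noteq> 0"
    using K by (intro tendsto_imp_eventually_ne) auto
  moreover have "(\<Sum>k=1..N. of_int (c k) * (real k / real K) ^ m) =
      (\<Sum>k=1..N. of_int (c k) * real k ^ m) / real K ^ m" for m
    by (simp add: sum_divide_distrib power_divide)
  ultimately show ?thesis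
    by (auto elim: eventually_mono)
qed

lemma dilation_relation_imp_polynomial:
  fixes f :: "real \<Rightarrow> real" and c :: "nat \<Rightarrow> int"
  assumes f: "real_analytic_on f {0..}"
    and c: "k0 \<in> {1..N}" "c k0 \<noteq> 0"
    and rel: "\<And>x. x \<ge> 0 \<Longrightarrow> (\<Sum>k=1..N. of_int (c k) * f (real k * x)) = 0"
  shows "\<exists>p. \<forall>x\<ge>0. f x = poly p x"
proof -
  have "0 \<in> {0::real..}" by simp
  then obtain r a where ra: "r > 0"
    "\<And>y. y \<ge> 0 \<Longrightarrow> \<bar>y\<bar> < r \<Longrightarrow> (\<lambda>n. a n * y ^ n) sums f y"
    using f unfolding real_analytic_on_def by (metis atLeast_iff diff_zero)
  have "N > 0" using c by auto
  \<comment> \<open>The \<open>m\<close>-th Taylor coefficient at 0 of the left-hand side of the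
    relation.\<close>
  define b where "b m = (\<Sum>k=1..N. of_int (c k) * real k ^ m) * a m" for m
  \<comment> \<open>The radius \<open>r / N\<close> keeps every dilate \<open>k * y\<close> with
    \<open>k \<le> N\<close> inside the interval of convergence of \<open>f\<close>. The form
    \<open>y - 0\<close> matches the lemma on isolated zeros at \<open>x = 0\<close>.\<close>
  have b_sums: "(\<lambda>m. b m * (y - 0) ^ m) sums 0" if "y \<ge> 0" "\<bar>y - 0\<bar> < r / N" for y
  proof -
    have "(\<lambda>m. of_int (c k) * (a m * (real k * y) ^ m)) sums (of_int (c k) * f (real k * y))"
      if k: "k \<in> {1..N}" for k
    proof -
      have "real k * y \<le> real N * y"
        using k \<open>y \<ge> 0\<close> by (intro mult_right_mono) auto
      also have "\<dots> < r"
        using \<open>\<bar>y - 0\<bar> < r / N\<close> \<open>y \<ge> 0\<close> \<open>N > 0\<close> by (simp add: field_simps)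
      finally show ?thesis
        using \<open>y \<ge> 0\<close> by (intro sums_mult ra(2)) auto
    qed
    then have "(\<lambda>m. \<Sum>k=1..N. of_int (c k) * (a m * (real k * y) ^ m)) sums
        (\<Sum>k=1..N. of_int (c k) * f (real k * y))"
      by (intro sums_sum)
    then show ?thesis
      using rel[OF \<open>y \<ge> 0\<close>]
      by (simp add: b_def sum_distrib_right sum_distrib_left power_mult_distrib mult_ac)
  qed
  \<comment> \<open>A nonzero coefficient would make the zero function nonzero at small positive
    points.\<close>
  have "b m = 0" for m
  proof (rule ccontr)
    assume "b m \<noteq> 0"
    then obtain s :: real where "s > 0" "\<forall>y\<ge>0. y = 0 \<or> \<not> y < s"
      using power_series_zeros_isolated[of "r / N" 0 b m "\<lambda>_. 0", OF _ _ _ b_sums] \<open>r > 0\<close> \<open>N > 0\<close>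
      by auto
    then show False
      by (auto dest!: spec[of _ "s / 2"])
  qed
  then have "\<forall>\<^sub>F m in sequentially. a m = 0"
    by (intro eventually_mono[OF eventually_power_sum_nonzero[of k0 N c, OF c]]) (metis b_def mult_eq_0_iff)
  then obtain M where M: "\<And>m. m \<ge> M \<Longrightarrow> a m = 0"
    by (auto simp: eventually_sequentially)
  define p where "p = Abs_poly a"
  have coeff_p: "coeff p = a"
    unfolding p_def using M
    by (intro coeff_Abs_poly[of M]) auto
  have "f y - poly p y = 0" if "y \<ge> 0" "y < r" for y
    using sums_unique2[OF ra(2)[of y] poly_sums[of p y, unfolded coeff_p]] that by simp
  \<comment> \<open>So far \<open>f\<close> agrees with \<open>p\<close> only on
    \<open>[0, r)\<close>; the identity theorem extends this to the half-line.\<close>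
  then have "{0..<r} \<subseteq> {x. x \<ge> 0 \<and> f x - poly p x = 0}"
    by auto
  moreover have "uncountable {0..<r}"
    using \<open>r > 0\<close> by (simp add: uncountable_half_open_interval_1)
  ultimately have "uncountable {x. x \<ge> 0 \<and> f x - poly p x = 0}"
    using countable_subset by blast
  from real_analytic_identity[OF real_analytic_on_diff_poly[OF f] this] show ?thesis
    by (intro exI[of _ p]) auto
qed

text \<open>The number 1 is not adjoined to the family. This fits the form of Kronecker's theorem in
  which the multiplier is an arbitrary real number.\<close>

definition int_independent :: "(nat \<Rightarrow> real) \<Rightarrow> bool" where
  "int_independent a \<longleftrightarrow>
     (\<forall>N (c :: nat \<Rightarrow> int). (\<Sum>k=1..N. of_int (c k) * a k) = 0 \<longrightarrow> (\<forall>k\<in>{1..N}. c k = 0))"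

lemma uncountable_dependent_imp_polynomial:
  fixes f :: "real \<Rightarrow> real"
  assumes f: "real_analytic_on f {0..}"
    and unc: "uncountable {u. u > 0 \<and> \<not> int_independent (\<lambda>k. f (real k * u))}"
  shows "\<exists>p. \<forall>x\<ge>0. f x = poly p x"
proof -
  define D where "D = {u. u > 0 \<and> \<not> int_independent (\<lambda>k. f (real k * u))}"
  \<comment> \<open>Relations are encoded as lists because integer lists form a countable type,
    unlike functions from \<open>nat\<close> to \<open>int\<close>. The shift \<open>k - 1\<close>
    reconciles indices starting at 1 with list positions starting at 0.\<close>
  define R where "R cs = {u. u > 0 \<and> (\<Sum>k=1..length cs. of_int (cs ! (k - 1)) * f (real k * u)) = 0}"
    for cs :: "int list"
  have "D \<subseteq> (\<Union>cs\<in>{cs. \<exists>i<length cs. cs ! i \<noteq> 0}. R cs)"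
  proof
    fix u assume "u \<in> D"
    then obtain N and c :: "nat \<Rightarrow> int" and k where
      c: "u > 0" "(\<Sum>k=1..N. of_int (c k) * f (real k * u)) = 0" "k \<in> {1..N}" "c k \<noteq> 0"
      unfolding D_def int_independent_def by blast
    define cs where "cs = map (\<lambda>i. c (Suc i)) [0..<N]"
    have "(\<Sum>k=1..length cs. of_int (cs ! (k - 1)) * f (real k * u)) =
        (\<Sum>k=1..N. of_int (c k) * f (real k * u))"
      by (intro sum.cong) (auto simp: cs_def)
    then have "u \<in> R cs"
      using c by (simp add: R_def)
    moreover have "\<exists>i<length cs. cs ! i \<noteq> 0"
      using c by (intro exI[of _ "k - 1"]) (auto simp: cs_def)
    ultimately show "u \<in> (\<Union>cs\<in>{cs. \<exists>i<length cs. cs ! i \<noteq> 0}. R cs)"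
      by blast
  qed
  then have "uncountable (\<Union>cs\<in>{cs. \<exists>i<length cs. cs ! i \<noteq> 0}. R cs)"
    using unc countable_subset unfolding D_def by blast
  then obtain cs i where cs: "i < length cs" "cs ! i \<noteq> 0" "uncountable (R cs)"
    using countable_UN[of "{cs. \<exists>i<length cs. cs ! i \<noteq> 0}" R] by auto
  define g where "g x = (\<Sum>k=1..length cs. of_int (cs ! (k - 1)) * f (real k * x))" for x
  have "real_analytic_on g {0..}"
    unfolding g_def using f by (intro real_analytic_on_sum real_analytic_on_scaled) auto
  moreover have "R cs \<subseteq> {x. x \<ge> 0 \<and> g x = 0}"
    by (auto simp: R_def g_def)
  then have "uncountable {x. x \<ge> 0 \<and> g x = 0}"
    using cs countable_subset by blast
  ultimately have "g x = 0" if "x \<ge> 0" for x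
    using real_analytic_identity that by blast
  then show ?thesis
    using dilation_relation_imp_polynomial[OF f, of "Suc i" "length cs" "\<lambda>k. cs ! (k - 1)"] cs
    by (auto simp: g_def)
qed

section \<open>Kronecker's theorem and orbits resting in short arcs\<close>

lemma int_independent_Kronecker:
  assumes a: "int_independent a" and "\<epsilon> > 0"
  obtains s h where "\<And>k. k \<in> {1..N} \<Longrightarrow> \<bar>s * a k - of_int (h k) - \<alpha> k\<bar> < \<epsilon>"
proof -
  \<comment> \<open>Makes \<open>independent\<close> and \<open>dependent\<close> refer to the reals
    as a module over the integers.\<close>
  interpret Modules.module "\<lambda>r. (*) (real_of_int r)"
    by (simp add: Modules.module.intro distrib_left mult.commute)
  define \<theta> where "\<theta> i = a (Suc i)" for i
  have ind: "c i = 0" if "(\<Sum>i<N. of_int (c i) * \<theta> i) = 0" "i < N" for c :: "nat \<Rightarrow> int" and i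
  proof -
    have "(\<Sum>k=1..N. of_int (c (k - 1)) * a k) = (\<Sum>i<N. of_int (c i) * \<theta> i)"
      unfolding \<theta>_def by (rule sum.reindex_bij_witness[of _ Suc "\<lambda>k. k - 1"]) auto
    then show ?thesis
      using a[unfolded int_independent_def, rule_format, of "\<lambda>k. c (k - 1)" N "Suc i"] that by auto
  qed
  \<comment> \<open>\<open>independent\<close> speaks of a set and cannot see repeated entries. Two
    equal entries would give a relation with coefficients 1 and -1.\<close>
  have inj: "inj_on \<theta> {..<N}"
  proof (rule inj_onI, rule ccontr)
    fix i j assume ij: "i \<in> {..<N}" "j \<in> {..<N}" "\<theta> i = \<theta> j" "i \<noteq> j"
    define c :: "nat \<Rightarrow> int" where "c l = (if l = i then 1 else 0) - (if l = j then 1 else 0)" for l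
    have "(\<Sum>l<N. of_int (c l) * \<theta> l) =
        (\<Sum>l<N. (if l = i then \<theta> l else 0) - (if l = j then \<theta> l else 0))"
      by (intro sum.cong) (auto simp: c_def)
    also have "\<dots> = 0"
      using ij by (simp add: sum_subtractf)
    finally have "c i = 0"
      using ij by (intro ind) auto
    then show False
      using ij by (simp add: c_def)
  qed
  have "independent (\<theta> ` {..<N})"
  proof
    assume "dependent (\<theta> ` {..<N})"
    then obtain u v where uv: "v \<in> \<theta> ` {..<N}" "u v \<noteq> 0" "(\<Sum>v\<in>\<theta> ` {..<N}. of_int (u v) * v) = 0"
      by (auto simp: dependent_finite)
    then have "(\<Sum>i<N. of_int (u (\<theta> i)) * \<theta> i) = 0"
      by (simp add: sum.reindex[OF inj])
    then show False
      using ind[of "\<lambda>i. u (\<theta> i)"] uv by auto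
  qed
  then obtain s h where "\<And>i. i < N \<Longrightarrow> \<bar>s * \<theta> i - of_int (h i) - \<alpha> (Suc i)\<bar> < \<epsilon>"
    using Kronecker_thm_1[of \<theta> N \<epsilon> "\<lambda>i. \<alpha> (Suc i)"] inj \<open>\<epsilon> > 0\<close> by metis
  then have "\<bar>s * a k - of_int (h (k - 1)) - \<alpha> k\<bar> < \<epsilon>" if "k \<in> {1..N}" for k
    using that by (cases k) (auto simp: \<theta>_def)
  then show thesis
    by (rule that[of s "\<lambda>k. h (k - 1)"])
qed

text \<open>One speed \<open>s\<close> serves all \<open>x\<close>; only \<open>n\<close> depends on
  \<open>x\<close>. The circle is cut into \<open>q\<close> arcs of length \<open>1 / q\<close>, and
  while \<open>k\<close> runs through the \<open>i\<close>-th block the rotation holds the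
  \<open>i\<close>-th arc inside \<open>[0, 3/q)\<close>.\<close>

lemma int_independent_sweep:
  assumes a: "int_independent a" and "n0 > 0" "q \<ge> 3"
  shows "\<exists>s. \<forall>x\<in>{0..<1}. \<exists>n\<ge>n0. 3 / 4 * real n \<le> card {k \<in> {1..n}. frac (x + s * a k) < 3 / real q}"
proof -
  \<comment> \<open>\<open>b k\<close> is the index of the block
    \<open>(n0 * 4 ^ i, n0 * 4 ^ Suc i]\<close> containing \<open>k\<close>; indices up to
    \<open>n0\<close> are put into block 0.\<close>
  define b where "b k = (LEAST i. k \<le> n0 * 4 ^ Suc i)" for k
  have b: "b k = i" if "n0 * 4 ^ i < k" "k \<le> n0 * 4 ^ Suc i" for i k
    unfolding b_def
  proof (rule Least_equality)
    fix j assume "k \<le> n0 * 4 ^ Suc j"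
    with that(1) have "n0 * 4 ^ i < n0 * 4 ^ Suc j"
      by linarith
    then have "(4::nat) ^ i < 4 ^ Suc j"
      by simp
    then show "i \<le> j"
      by (subst (asm) power_strict_increasing_iff) auto
  qed (use that in auto)
  \<comment> \<open>Translation by \<open>(1 - i) / q\<close> maps \<open>[i/q, (i+1)/q)\<close> to \<open>[1/q, 2/q)\<close>, which leaves a margin of \<open>1/q\<close>
    on both sides for the error in Kronecker's theorem.\<close>
  obtain s h where s: "\<And>k. k \<in> {1..n0 * 4 ^ q} \<Longrightarrow> \<bar>s * a k - of_int (h k) - (1 - real (b k)) / q\<bar> < 1 / q"
    using int_independent_Kronecker[OF a, of "1 / q" "n0 * 4 ^ q" "\<lambda>k. (1 - real (b k)) / q"] \<open>q \<ge> 3\<close> by auto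
  have "\<exists>n\<ge>n0. 3 / 4 * real n \<le> card {k \<in> {1..n}. frac (x + s * a k) < 3 / real q}"
    if x: "x \<in> {0..<1}" for x
  proof -
    \<comment> \<open>The number of the arc of length \<open>1 / q\<close> that contains
      \<open>x\<close>.\<close>
    define i where "i = nat \<lfloor>x * q\<rfloor>"
    have "0 \<le> x * q" "x * q < q"
      using x \<open>q \<ge> 3\<close> by auto
    then have i: "real i \<le> x * q" "x * q < real i + 1" "i < q"
      unfolding i_def by linarith+
    \<comment> \<open>The end of block \<open>i\<close>, which makes up exactly three quarters of
      \<open>{1..n}\<close>.\<close>
    define n where "n = n0 * 4 ^ Suc i"
    have "{n0 * 4 ^ i <.. n} \<subseteq> {k \<in> {1..n}. frac (x + s * a k) < 3 / real q}"
    proof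
      fix k assume k: "k \<in> {n0 * 4 ^ i <.. n}"
      have "n \<le> n0 * 4 ^ q"
        unfolding n_def using \<open>i < q\<close> by (intro mult_left_mono power_increasing) auto
      with k have "k \<in> {1..n0 * 4 ^ q}"
        by auto
      moreover have "b k = i"
        using b[of i k] k by (auto simp: n_def)
      ultimately have *: "\<bar>s * a k - of_int (h k) - (1 - real i) / q\<bar> < 1 / q"
        using s[of k] by simp
      define z where "z = x + s * a k - of_int (h k)"
      \<comment> \<open>In units of \<open>1 / q\<close>: the position of \<open>x\<close> in its
        arc lies in \<open>[0, 1)\<close>, the shift adds 1, and the Kronecker error is below 1 in
        absolute value.\<close>
      have "z * q = x * q + 1 - i + (s * a k - of_int (h k) - (1 - real i) / q) * q"
        using \<open>q \<ge> 3\<close> by (simp add: z_def field_simps)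
      moreover have "\<bar>(s * a k - of_int (h k) - (1 - real i) / q) * q\<bar> < 1"
        using * \<open>q \<ge> 3\<close> by (simp only: abs_mult) (simp add: pos_less_divide_eq)
      ultimately have "0 < z * q" "z * q < 3"
        using i by linarith+
      then have "0 \<le> z" "z < 3 / q"
        using \<open>q \<ge> 3\<close> by (auto simp: field_simps zero_less_mult_iff)
      moreover have "3 / real q \<le> 1"
        using \<open>q \<ge> 3\<close> by simp
      ultimately have "frac z = z" 
        by (auto simp: frac_eq)
      moreover have "frac (x + s * a k) = frac z"
        unfolding z_def by (simp add: frac_def)
      ultimately show "k \<in> {k \<in> {1..n}. frac (x + s * a k) < 3 / real q}"
        using k \<open>z < 3 / q\<close> by auto
    qed
    then have "card {n0 * 4 ^ i <.. n} \<le> card {k \<in> {1..n}. frac (x + s * a k) < 3 / real q}"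
      by (intro card_mono) auto
    moreover have "4 * card {n0 * 4 ^ i <.. n} = 3 * n"
      by (simp add: n_def)
    moreover have "n0 \<le> n"
      by (simp add: n_def)
    ultimately show ?thesis
      by (intro exI[of _ n]) linarith
  qed
  then show ?thesis
    by blast
qed

section \<open>Rotations of the circle\<close>

text \<open>The circle is represented by the fundamental domain \<open>[0, 1)\<close>, with
  \<open>frac\<close> as the projection from the line.\<close>

definition circle_measure :: "real measure" where
  "circle_measure = restrict_space lborel {0..<1}"

lemma space_circle [simp]: "space circle_measure = {0..<1}"
  by (simp add: circle_measure_def space_restrict_space)

lemma sets_circle: "A \<in> sets circle_measure \<longleftrightarrow> A \<in> sets borel \<and> A \<subseteq> {0..<1}"
  by (auto simp: circle_measure_def sets_restrict_space_iff)

lemma emeasure_circle: "A \<subseteq> {0..<1} \<Longrightarrow> emeasure circle_measure A = emeasure lborel A"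
  by (simp add: circle_measure_def emeasure_restrict_space)

lemma prob_space_circle: "prob_space circle_measure"
  by (rule prob_spaceI) (simp add: emeasure_circle)

lemma measurable_frac_circle [measurable (raw)]:
  assumes "f \<in> borel_measurable M"
  shows "(\<lambda>x. frac (f x)) \<in> measurable M circle_measure"
  unfolding circle_measure_def
proof (rule measurable_restrict_space2)
  show "(\<lambda>x. frac (f x)) \<in> measurable M lborel"
    unfolding frac_def using assms by measurable
qed (simp add: frac_lt_1)

lemma measurable_from_circle [measurable]: "(\<lambda>x. x) \<in> borel_measurable circle_measure"
  unfolding circle_measure_def by (rule measurable_restrict_space1) simp

lemma emeasure_lborel_translate:
  fixes c :: real
  assumes "A \<in> sets borel"
  shows "emeasure lborel {x. x + c \<in> A} = emeasure lborel A"
proof -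
  have "emeasure (distr lborel borel ((+) c)) A = emeasure lborel ((+) c -` A \<inter> space lborel)"
    using assms by (intro emeasure_distr) auto
  then show ?thesis
    by (simp add: lborel_distr_plus vimage_def add.commute)
qed

text \<open>A rotation exchanges two intervals: \<open>[0, 1 - t)\<close> moves right by
  \<open>t\<close> and \<open>[1 - t, 1)\<close> moves left by \<open>1 - t\<close>. Their images
  are the parts of the circle above and below \<open>t\<close>, and translations preserve Lebesgue
  measure.\<close>

lemma rotation_preserves_circle:
  assumes A: "A \<in> sets circle_measure"
  shows "emeasure circle_measure {x \<in> {0..<1}. frac (x + s) \<in> A} = emeasure circle_measure A"
proof -
  define t where "t = frac s"
  have t: "0 \<le> t" "t < 1"
    by (auto simp: t_def frac_lt_1)
  have A': "A \<in> sets borel" "A \<subseteq> {0..<1}"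
    using A by (auto simp: sets_circle)
  have frac: "frac (x + s) = (if x + t < 1 then x + t else x + (t - 1))" if "x \<in> {0..<1}" for x
  proof -
    have "frac (x + s) = frac (x + t)"
      using frac_add_of_int_right[of "x + t" "\<lfloor>s\<rfloor>"] by (simp add: t_def frac_def)
    then show ?thesis
      using that t by (simp add: frac_eq) (simp add: frac_unique_iff)
  qed
  have eq: "{x \<in> {0..<1}. frac (x + s) \<in> A} = {x. x + t \<in> A \<inter> {t..}} \<union> {x. x + (t - 1) \<in> A \<inter> {..<t}}"
  proof (intro set_eqI iffI)
    fix x assume "x \<in> {x \<in> {0..<1}. frac (x + s) \<in> A}"
    then show "x \<in> {x. x + t \<in> A \<inter> {t..}} \<union> {x. x + (t - 1) \<in> A \<inter> {..<t}}"
      using frac[of x] by (auto split: if_splits)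
  next
    fix x assume "x \<in> {x. x + t \<in> A \<inter> {t..}} \<union> {x. x + (t - 1) \<in> A \<inter> {..<t}}"
    moreover from this have "x \<in> {0..<1}"
      using A'(2) t by force
    moreover from calculation have "x + t < 1 \<longleftrightarrow> x + t \<in> A \<inter> {t..}"
      using A'(2) t by force
    ultimately show "x \<in> {x \<in> {0..<1}. frac (x + s) \<in> A}"
      using frac[of x] by auto
  qed
  have "emeasure circle_measure {x \<in> {0..<1}. frac (x + s) \<in> A} =
      emeasure lborel ({x. x + t \<in> A \<inter> {t..}} \<union> {x. x + (t - 1) \<in> A \<inter> {..<t}})"
    unfolding eq[symmetric] by (rule emeasure_circle) auto
  also have "\<dots> = emeasure lborel {x. x + t \<in> A \<inter> {t..}} + emeasure lborel {x. x + (t - 1) \<in> A \<inter> {..<t}}"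
  proof (rule plus_emeasure[symmetric])
    show "{x. x + t \<in> A \<inter> {t..}} \<inter> {x. x + (t - 1) \<in> A \<inter> {..<t}} = {}"
    proof -
      have False if "x + t \<in> A" "x + (t - 1) \<in> A" for x
        using that[THEN subsetD[OF A'(2)]] by simp
      then show ?thesis
        by blast
    qed
  qed (use A'(1) in measurable)
  also have "\<dots> = emeasure lborel (A \<inter> {t..}) + emeasure lborel (A \<inter> {..<t})"
    using A'(1) by (simp only: emeasure_lborel_translate sets.Int borel_closed closed_atLeast borel_open open_lessThan)
  also have "\<dots> = emeasure lborel ((A \<inter> {t..}) \<union> (A \<inter> {..<t}))"
    using A'(1) by (intro plus_emeasure) auto
  also have "(A \<inter> {t..}) \<union> (A \<inter> {..<t}) = A"
    by auto
  finally show ?thesis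
    by (simp add: emeasure_circle[OF A'(2)])
qed

section \<open>The linear flow on the infinite torus\<close>

text \<open>Countably many coordinates give points of type \<open>nat \<Rightarrow> real\<close>,
  the type over which \<open>pointwise_good\<close> quantifies.\<close>

definition torus_measure :: "(nat \<Rightarrow> real) measure" where
  "torus_measure = PiM UNIV (\<lambda>_. circle_measure)"

definition torus_flow :: "(nat \<Rightarrow> real) \<Rightarrow> real \<Rightarrow> (nat \<Rightarrow> real) \<Rightarrow> nat \<Rightarrow> real" where
  "torus_flow s t x = (\<lambda>j. frac (x j + s j * t))"

interpretation torus: product_prob_space "\<lambda>_. circle_measure" "UNIV :: nat set"
  by (intro product_prob_spaceI prob_space_circle)

lemma space_torus: "x \<in> space torus_measure \<longleftrightarrow> (\<forall>j. x j \<in> {0..<1})"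
  by (auto simp: torus_measure_def space_PiM PiE_iff)

lemma torus_coordinate_measurable [measurable]: "(\<lambda>x. x j) \<in> borel_measurable torus_measure"
  unfolding torus_measure_def
  by (rule measurable_compose[OF _ measurable_from_circle]) measurable

lemma torus_flow_jointly_measurable:
  "(\<lambda>(t, x). torus_flow s t x) \<in> measurable (borel \<Otimes>\<^sub>M torus_measure) torus_measure"
proof -
  have "(\<lambda>p. \<lambda>j\<in>UNIV. frac (snd p j + s j * fst p)) \<in> measurable (borel \<Otimes>\<^sub>M torus_measure) (PiM UNIV (\<lambda>_. circle_measure))"
    by (intro measurable_restrict measurable_frac_circle) measurable
  then show ?thesis
    by (simp add: torus_flow_def torus_measure_def[symmetric] case_prod_unfold restrict_UNIV)
qed

lemma torus_flow_measurable [measurable]: "torus_flow s t \<in> measurable torus_measure torus_measure"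
  using measurable_compose[OF measurable_Pair1' torus_flow_jointly_measurable, of t] by simp

text \<open>The product measure is determined by finite-dimensional cylinders. The flow pulls a
  cylinder back to a cylinder, rotating each coordinate separately.\<close>

lemma torus_flow_measure_preserving: "distr torus_measure torus_measure (torus_flow s t) = torus_measure"
proof -
  have "distr torus_measure torus_measure (torus_flow s t) = PiM UNIV (\<lambda>_. circle_measure)"
  proof (rule torus.PiM_eq)
    fix J :: "nat set" and A assume J: "finite J" "\<And>j. j \<in> J \<Longrightarrow> A j \<in> sets circle_measure"
    define B where "B j = {x \<in> {0..<1}. frac (x + s j * t) \<in> A j}" for j
    have B: "B j \<in> sets circle_measure" if "j \<in> J" for j
    proof -
      have "(\<lambda>x. frac (x + s j * t)) -` A j \<inter> space circle_measure \<in> sets circle_measure"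
        by (rule measurable_sets[OF _ J(2)[OF that]]) measurable
      then show ?thesis
        by (simp add: B_def vimage_def Int_def conj_commute)
    qed
    have "emeasure (distr torus_measure torus_measure (torus_flow s t)) (torus.emb UNIV J (Pi\<^sub>E J A)) =
        emeasure torus_measure (torus_flow s t -` torus.emb UNIV J (Pi\<^sub>E J A) \<inter> space torus_measure)"
      using J by (intro emeasure_distr) (auto simp: torus_measure_def[symmetric] intro!: sets_PiM_I[of J UNIV A "\<lambda>_. circle_measure", folded torus_measure_def])
    also have "torus_flow s t -` torus.emb UNIV J (Pi\<^sub>E J A) \<inter> space torus_measure = torus.emb UNIV J (Pi\<^sub>E J B)"
      by (auto simp: prod_emb_def torus_measure_def space_PiM PiE_iff B_def torus_flow_def frac_lt_1)
    also have "emeasure torus_measure \<dots> = (\<Prod>j\<in>J. emeasure circle_measure (B j))"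
      unfolding torus_measure_def using J(1) B by (intro torus.emeasure_PiM_emb) auto
    also have "\<dots> = (\<Prod>j\<in>J. emeasure circle_measure (A j))"
      using J by (intro prod.cong refl) (simp only: B_def rotation_preserves_circle)
    finally show "emeasure (distr torus_measure torus_measure (torus_flow s t)) (torus.emb UNIV J (Pi\<^sub>E J A)) =
        (\<Prod>j\<in>J. emeasure circle_measure (A j))" .
  qed (simp add: torus_measure_def)
  then show ?thesis
    by (simp add: torus_measure_def)
qed

lemma prob_space_torus: "prob_space torus_measure"
  unfolding torus_measure_def by (rule torus.prob_space_axioms)

lemma torus_flow_is_flow: "measure_preserving_flow torus_measure (torus_flow s)"
  unfolding measure_preserving_flow_def
proof (intro conjI allI ballI prob_space_torus torus_flow_measurable torus_flow_measure_preserving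
    torus_flow_jointly_measurable)
  fix x assume "x \<in> space torus_measure"
  then show "torus_flow s 0 x = x"
    by (auto simp: torus_flow_def space_torus frac_eq)
next
  fix u t x
  have "frac (x j + s j * (u + t)) = frac (frac (x j + s j * t) + s j * u)" for j
    by (simp add: frac_def algebra_simps)
  then show "torus_flow s (u + t) x = torus_flow s u (torus_flow s t x)"
    by (simp add: torus_flow_def)
qed

section \<open>Divergence of averages for independent sequences\<close>

lemma int_independent_imp_not_pointwise_good:
  assumes a: "int_independent a"
  shows "\<not> pointwise_good a"
proof
  assume good: "pointwise_good a"
  interpret T: prob_space torus_measure
    by (rule prob_space_torus)
  \<comment> \<open>Chosen so that the arc lengths \<open>3 / q j = (1/8) * (1/2) ^ j\<close> sum to
    \<open>1/4\<close>.\<close>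
  define q :: "nat \<Rightarrow> nat" where "q j = 24 * 2 ^ j" for j
  have q: "q j \<ge> 3" for j
    using one_le_power[of "2::nat" j] by (simp add: q_def)
  \<comment> \<open>Taking \<open>Suc j\<close> as the lower bound makes coordinate \<open>j\<close>
    supply a positive \<open>n\<close> beyond \<open>j\<close>, so all coordinates together supply
    arbitrarily large \<open>n\<close> for each point.\<close>
  have "\<forall>j. \<exists>s. \<forall>x\<in>{0..<1}. \<exists>n\<ge>Suc j. 3 / 4 * real n \<le> card {k \<in> {1..n}. frac (x + s * a k) < 3 / real (q j)}"
    using int_independent_sweep[OF a _ q] by blast
  from choice[OF this] obtain s where s: "\<And>j x. x \<in> {0..<1} \<Longrightarrow>
      \<exists>n\<ge>Suc j. 3 / 4 * real n \<le> card {k \<in> {1..n}. frac (x + s j * a k) < 3 / real (q j)}"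
    by blast
  define E where "E = {x \<in> space torus_measure. \<exists>j. x j < 3 / real (q j)}"
  have E [measurable]: "E \<in> sets torus_measure"
    unfolding E_def by measurable
  have flow_space: "torus_flow s t x \<in> space torus_measure" for t x
    by (simp add: space_torus torus_flow_def frac_lt_1)
  have prob_E: "T.prob E \<le> 1 / 4"
  proof -
    define E' where "E' j = {x \<in> space torus_measure. x j \<in> {0..<3 / real (q j)}}" for j
    have "T.prob (E' j) = 3 / real (q j)" for j
    proof -
      have "3 / real (q j) \<le> 1"
        using q[of j] by simp
      then have "emeasure torus_measure (E' j) = emeasure lborel {0..<3 / real (q j)}"
        unfolding E'_def torus_measure_def
        by (subst torus.emeasure_PiM_Collect_single) (auto simp: sets_circle emeasure_circle)
      then show ?thesis
        by (simp add: measure_def)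
    qed
    then have prob_E': "T.prob (E' j) = 1 / 8 * (1 / 2) ^ j" for j
      by (simp add: q_def power_divide)
    have sums: "(\<lambda>j. 1 / 8 * (1 / 2) ^ j :: real) sums (1 / 8 * 2)"
      using geometric_sums[of "1 / 2 :: real"] by (intro sums_mult) simp
    have "E = (\<Union>j. E' j)"
      by (auto simp: E_def E'_def space_torus)
    moreover have "T.prob (\<Union>j. E' j) \<le> (\<Sum>j. T.prob (E' j))"
    proof (rule T.finite_measure_subadditive_countably)
      show "range E' \<subseteq> T.events"
        unfolding E'_def by auto
    qed (use sums in \<open>simp add: prob_E' sums_iff\<close>)
    ultimately show ?thesis
      using sums by (simp add: prob_E' sums_iff)
  qed
  define F :: "(nat \<Rightarrow> real) \<Rightarrow> real" where "F = indicator E"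
  define avg where "avg n x = (\<Sum>k=1..n. F (torus_flow s (a k) x)) / real n" for n x
  have F_meas [measurable]: "F \<in> borel_measurable torus_measure"
    unfolding F_def by measurable
  have F_bounds: "0 \<le> F x" "F x \<le> 1" for x
    by (auto simp: F_def indicator_def)
  have avg_meas [measurable]: "avg n \<in> borel_measurable torus_measure" for n
    unfolding avg_def by measurable
  have avg_bound: "norm (avg n x) \<le> 1" for n x
  proof -
    have "(\<Sum>k=1..n. F (torus_flow s (a k) x)) \<le> of_nat (card {1..n}) * 1"
      using F_bounds by (intro sum_bounded_above)
    moreover have "0 \<le> (\<Sum>k=1..n. F (torus_flow s (a k) x))"
      using F_bounds by (intro sum_nonneg)
    ultimately show ?thesis
      by (auto simp: avg_def divide_le_eq)
  qed
  have int_F: "(\<integral>x. F (torus_flow s t x) \<partial>torus_measure) = T.prob E" for t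
  proof -
    have "(\<integral>x. F (torus_flow s t x) \<partial>torus_measure) = (\<integral>x. F x \<partial>distr torus_measure torus_measure (torus_flow s t))"
      by (rule integral_distr[symmetric]) measurable
    then show ?thesis
      by (simp add: torus_flow_measure_preserving F_def)
  qed
  have int_avg: "(\<integral>x. avg n x \<partial>torus_measure) \<le> 1 / 4" for n
  proof -
    have "integrable torus_measure (\<lambda>x. F (torus_flow s t x))" for t
      using F_bounds by (intro T.integrable_const_bound[of _ 1]) auto
    then have "(\<integral>x. avg n x \<partial>torus_measure) = (\<Sum>k=1..n. T.prob E) / real n"
      by (simp add: avg_def int_F del: sum_constant)
    \<comment> \<open>Only an inequality, since for \<open>n = 0\<close> the quotient is 0.\<close>
    also have "\<dots> \<le> T.prob E"
      by (cases "n = 0") auto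
    finally show ?thesis
      using prob_E by simp
  qed
  have often: "\<exists>n\<ge>m. 3 / 4 \<le> avg n x" if "x \<in> space torus_measure" for m x
  proof -
    have "x m \<in> {0..<1}"
      using that by (simp add: space_torus)
    then obtain n where n: "n \<ge> Suc m"
      "3 / 4 * real n \<le> card {k \<in> {1..n}. frac (x m + s m * a k) < 3 / real (q m)}"
      using s by blast
    have "real (card {k \<in> {1..n}. frac (x m + s m * a k) < 3 / real (q m)}) =
        (\<Sum>k=1..n. if frac (x m + s m * a k) < 3 / real (q m) then 1 else 0)"
      by (simp add: sum.If_cases Int_def)
    \<comment> \<open>Coordinate \<open>m\<close> in its short arc is enough to place the whole
      point in \<open>E\<close>.\<close>
    also have "\<dots> \<le> (\<Sum>k=1..n. F (torus_flow s (a k) x))"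
      using flow_space by (intro sum_mono) (auto simp: F_def E_def torus_flow_def indicator_def)
    finally have "3 / 4 \<le> avg n x"
      using n by (simp add: avg_def le_divide_eq)
    then show ?thesis
      using n by (intro exI[of _ n]) auto
  qed
  have conv: "AE x in torus_measure. convergent (\<lambda>n. avg n x)"
  proof -
    have "\<exists>C. AE x in torus_measure. \<bar>F x\<bar> \<le> C"
      using F_bounds by (intro exI[of _ 1]) (auto simp: abs_le_iff)
    then show ?thesis
      using good torus_flow_is_flow[of s] F_meas unfolding pointwise_good_def avg_def by blast
  qed
  \<comment> \<open>\<open>lim\<close> is total, so \<open>L\<close> is defined and measurable
    everywhere; it is the actual limit almost everywhere.\<close>
  define L where "L x = lim (\<lambda>n. avg n x)" for x
  have L_meas [measurable]: "L \<in> borel_measurable torus_measure"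
    unfolding L_def by measurable
  have lim: "AE x in torus_measure. (\<lambda>n. avg n x) \<longlonglongrightarrow> L x"
    using conv by eventually_elim (simp add: L_def convergent_LIMSEQ_iff)
  have L_ge: "AE x in torus_measure. 3 / 4 \<le> L x"
    using lim AE_space
  proof eventually_elim
    case (elim x)
    show ?case
    proof (rule ccontr)
      assume "\<not> 3 / 4 \<le> L x"
      then have "\<forall>\<^sub>F n in sequentially. avg n x < 3 / 4"
        using elim(1) by (intro order_tendstoD(2)) auto
      then show False
        using often[OF elim(2)] by (force simp: eventually_sequentially)
    qed
  qed
  have dom: "integrable torus_measure L" "(\<lambda>n. \<integral>x. avg n x \<partial>torus_measure) \<longlonglongrightarrow> (\<integral>x. L x \<partial>torus_measure)"
    using lim avg_bound
    by (auto intro!: integrable_dominated_convergence[where w = "\<lambda>_. 1" and s = avg]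
        integral_dominated_convergence[where w = "\<lambda>_. 1"])
  \<comment> \<open>Invariance of the measure bounds every integral of \<open>avg n\<close>, hence
    that of the limit, by \<open>1/4\<close>, while \<open>L\<close> is at least \<open>3/4\<close>
    almost everywhere.\<close>
  have "(\<integral>x. L x \<partial>torus_measure) \<le> 1 / 4"
    using dom(2) int_avg by (intro LIMSEQ_le_const2) auto
  moreover have "3 / 4 \<le> (\<integral>x. L x \<partial>torus_measure)"
    using integral_mono_AE[OF _ dom(1) L_ge] by (simp add: T.prob_space)
  ultimately show False
    by simp
qed

theorem theorem1:
  fixes f :: "real \<Rightarrow> real"
  assumes "real_analytic_on f {0..}"
    and "uncountable {u :: real. u > 0 \<and> pointwise_good (\<lambda>k. f (real k * u))}"
  shows "\<exists>p :: real poly. \<forall>x \<ge> 0. f x = poly p x"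
proof (rule uncountable_dependent_imp_polynomial[OF assms(1)])
  have "{u. u > 0 \<and> pointwise_good (\<lambda>k. f (real k * u))} \<subseteq>
      {u. u > 0 \<and> \<not> int_independent (\<lambda>k. f (real k * u))}"
    using int_independent_imp_not_pointwise_good by blast
  with assms(2) show "uncountable {u. u > 0 \<and> \<not> int_independent (\<lambda>k. f (real k * u))}"
    using countable_subset by blast
qed

end
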